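(* The $p=1$ Koszul flattenings for minimal border rank and the 111-equations are independent, in the sense that neither implies the other, even for concise tensors in $\mathbb C^m\otimes\mathbb C^m\otimes\mathbb C^m$. That is: there exist $m$ and a concise tensor $T\in\mathbb C^m\otimes\mathbb C^m\otimes\mathbb C^m$ that satisfies all the $p=1$ Koszul flattening equations but not the 111-equations, and there exist $m$ and a concise tensor $T\in\mathbb C^m\otimes\mathbb C^m\otimes\mathbb C^m$ that satisfies the 111-equations but not all the $p=1$ Koszul flattening equations.
   Context: Let $A,B,C$ be complex vector spaces of dimension $m$ and $T\in A\otimes B\otimes C$. View $T$ as linear maps $T_A:A^*\to B\otimes C$, $T_B:B^*\to A\otimes C$, $T_C:C^*\to A\otimes B$ with images $T(A^* ),T(B^* ),T(C^* )$. $T$ is concise if all three maps are injective. 111-equations: regard $T(A^* )\otimes A$, $T(B^* )\otimes B$, $T(C^* )\otimes C$ as subspaces of $A\otimes B\otimes C$ (with factors put in the correct positions). The 111-equations say that the linear map $$(T(A^* )\otimes A)\oplus (T(B^* )\otimes B)\oplus (T(C^* )\otimes C)\to (A\otimes B\otimes C)\oplus (A\otimes B\otimes C),\quad (T_1,T_2,T_3)\mapsto (T_1-T_2,\,T_2-T_3)$$ has rank at most $3m^2-m$. $p=1$ Koszul flattenings: choose bases $\{a_i\},\{b_j\},\{c_k\}$ of $A,B,C$ and write $T=\sum T^{ijk}a_i\otimes b_j\otimes c_k$. The $p=1$ Koszul flattenings of type 210 are the minors of size $m(m-1)+1$ of the linear map $$T_A^{\wedge 1}:A\otimes B^*\to\Lambda^2A\otimes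 C,\qquad a\otimes\beta\mapsto\sum_{i,j,k}T^{ijk}\beta(b_j)\,a\wedge a_i\otimes c_k .$$ Types 201, 120, etc. are defined by permuting the roles of $A,B,C$; together they are called the $p=1$ Koszul flattenings, and $T$ satisfies these equations if all these minors vanish. *)

theory Defs
  imports
    Complex_Main
    "HOL-Library.Function_Algebras"
    "HOL-Library.Product_Plus"
    "Jordan_Normal_Form.Determinant"
begin

text \<open>
  We work in coordinates: \<open>A = B = C = \<complex>\<^sup>m\<close> with standard bases indexed by \<open>{..<m}\<close>, and dual
  spaces carry the dual bases.  A vector, matrix or tensor is the function giving its coordinates
  (\<open>T (i, j, k)\<close> is \<open>T\<^sup>i\<^sup>j\<^sup>k\<close>), required to vanish outside the index range, so that
  equality of functions is equality of tensors.
\<close>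

type_synonym vect = "nat \<Rightarrow> complex"
type_synonym mtrx = "nat \<times> nat \<Rightarrow> complex"
type_synonym tensor = "nat \<times> nat \<times> nat \<Rightarrow> complex"

definition fscale :: "complex \<Rightarrow> ('i \<Rightarrow> complex) \<Rightarrow> 'i \<Rightarrow> complex" where
  "fscale c f = (\<lambda>x. c * f x)"

definition pscale ::
  "complex \<Rightarrow> ('i \<Rightarrow> complex) \<times> ('j \<Rightarrow> complex) \<Rightarrow> ('i \<Rightarrow> complex) \<times> ('j \<Rightarrow> complex)" where
  "pscale c p = (fscale c (fst p), fscale c (snd p))"

interpretation fn: vector_space fscale
  by unfold_locales (simp_all add: fscale_def fun_eq_iff algebra_simps)

interpretation fnpair: vector_space pscale
  by unfold_locales
    (simp_all add: pscale_def fscale_def prod_eq_iff fun_eq_iff algebra_simps)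

definition vectors :: "nat \<Rightarrow> vect set" where
  "vectors m = {v. \<forall>i. i \<ge> m \<longrightarrow> v i = 0}"

definition tensors :: "nat \<Rightarrow> tensor set" where
  "tensors m = {T. \<forall>i j k. \<not> (i < m \<and> j < m \<and> k < m) \<longrightarrow> T (i, j, k) = 0}"

definition unit_vect :: "nat \<Rightarrow> vect" where
  "unit_vect i = (\<lambda>j. if j = i then 1 else 0)"


subsection \<open>Flattenings and conciseness\<close>

definition flat_A :: "nat \<Rightarrow> tensor \<Rightarrow> vect \<Rightarrow> mtrx" where
  "flat_A m T \<alpha> = (\<lambda>(j, k). \<Sum>i<m. \<alpha> i * T (i, j, k))"

definition flat_B :: "nat \<Rightarrow> tensor \<Rightarrow> vect \<Rightarrow> mtrx" where
  "flat_B m T \<beta> = (\<lambda>(i, k). \<Sum>j<m. \<beta> j * T (i, j, k))"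

definition flat_C :: "nat \<Rightarrow> tensor \<Rightarrow> vect \<Rightarrow> mtrx" where
  "flat_C m T \<gamma> = (\<lambda>(i, j). \<Sum>k<m. \<gamma> k * T (i, j, k))"

definition concise :: "nat \<Rightarrow> tensor \<Rightarrow> bool" where
  "concise m T \<longleftrightarrow>
     inj_on (flat_A m T) (vectors m) \<and>
     inj_on (flat_B m T) (vectors m) \<and>
     inj_on (flat_C m T) (vectors m)"


subsection \<open>The 111-equations\<close>

text \<open>
  The subspaces \<open>T(A\<^sup>*) \<otimes> A\<close>, \<open>T(B\<^sup>*) \<otimes> B\<close> and \<open>T(C\<^sup>*) \<otimes> C\<close> of \<open>A \<otimes> B \<otimes> C\<close>, as spans of products
  with the extra vector inserted in the \<open>A\<close>-, \<open>B\<close>- and \<open>C\<close>-position respectively.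
\<close>

definition TA_A :: "nat \<Rightarrow> tensor \<Rightarrow> tensor set" where
  "TA_A m T = fn.span {(\<lambda>(i, j, k). M (j, k) * a i) | M a.
     M \<in> flat_A m T ` vectors m \<and> a \<in> vectors m}"

definition TB_B :: "nat \<Rightarrow> tensor \<Rightarrow> tensor set" where
  "TB_B m T = fn.span {(\<lambda>(i, j, k). M (i, k) * b j) | M b.
     M \<in> flat_B m T ` vectors m \<and> b \<in> vectors m}"

definition TC_C :: "nat \<Rightarrow> tensor \<Rightarrow> tensor set" where
  "TC_C m T = fn.span {(\<lambda>(i, j, k). M (i, j) * c k) | M c.
     M \<in> flat_C m T ` vectors m \<and> c \<in> vectors m}"

definition map_111 :: "tensor \<times> tensor \<times> tensor \<Rightarrow> tensor \<times> tensor" where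
  "map_111 = (\<lambda>(T1, T2, T3). (T1 - T2, T2 - T3))"

definition satisfies_111 :: "nat \<Rightarrow> tensor \<Rightarrow> bool" where
  "satisfies_111 m T \<longleftrightarrow>
     fnpair.dim (map_111 ` (TA_A m T \<times> TB_B m T \<times> TC_C m T)) \<le> 3 * m\<^sup>2 - m"


subsection \<open>The \<open>p = 1\<close> Koszul flattenings\<close>

text \<open>
  For \<open>s < t\<close>, \<open>wedge u v (s, t)\<close> is the coefficient of \<open>u \<and> v\<close> at the basis vector
  \<open>a\<^sub>s \<and> a\<^sub>t\<close> of \<open>\<Lambda>\<^sup>2 A\<close>.
\<close>

definition wedge :: "vect \<Rightarrow> vect \<Rightarrow> nat \<times> nat \<Rightarrow> complex" where
  "wedge u v = (\<lambda>(s, t). u s * v t - u t * v s)"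

text \<open>
  \<open>koszul_map m T a \<beta>\<close> is the image of \<open>a \<otimes> \<beta>\<close>; its value at \<open>((s, t), l)\<close> with \<open>s < t\<close> is the
  coefficient at \<open>(a\<^sub>s \<and> a\<^sub>t) \<otimes> c\<^sub>l\<close>.
\<close>

definition koszul_map ::
  "nat \<Rightarrow> tensor \<Rightarrow> vect \<Rightarrow> vect \<Rightarrow> (nat \<times> nat) \<times> nat \<Rightarrow> complex" where
  "koszul_map m T a \<beta> = (\<lambda>(st, l). \<Sum>i<m. \<Sum>j<m. \<Sum>k<m.
     T (i, j, k) * \<beta> j * wedge a (unit_vect i) st * unit_vect k l)"

definition koszul_rows :: "nat \<Rightarrow> ((nat \<times> nat) \<times> nat) set" where
  "koszul_rows m = {((s, t), l) | s t l. s < t \<and> t < m \<and> l < m}"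

definition koszul_cols :: "nat \<Rightarrow> (nat \<times> nat) set" where
  "koszul_cols m = {..<m} \<times> {..<m}"

definition koszul_entry :: "nat \<Rightarrow> tensor \<Rightarrow> (nat \<times> nat) \<times> nat \<Rightarrow> nat \<times> nat \<Rightarrow> complex" where
  "koszul_entry m T = (\<lambda>stl (i, j). koszul_map m T (unit_vect i) (unit_vect j) stl)"

text \<open>
  The minors of size \<open>r\<close> of a matrix \<open>M\<close> with arbitrary finite index sets \<open>R\<close> and \<open>S\<close>.  The chosen
  rows and columns are listed in any order, which affects the minor only by its sign.
\<close>

definition minors_vanish ::
  "nat \<Rightarrow> 'r set \<Rightarrow> 's set \<Rightarrow> ('r \<Rightarrow> 's \<Rightarrow> complex) \<Rightarrow> bool" where
  "minors_vanish r R S M \<longleftrightarrow>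
     (\<forall>rs cs. distinct rs \<and> length rs = r \<and> set rs \<subseteq> R \<and>
              distinct cs \<and> length cs = r \<and> set cs \<subseteq> S \<longrightarrow>
        det (mat r r (\<lambda>(p, q). M (rs ! p) (cs ! q))) = 0)"

definition koszul_210 :: "nat \<Rightarrow> tensor \<Rightarrow> bool" where
  "koszul_210 m T \<longleftrightarrow>
     minors_vanish (m * (m - 1) + 1) (koszul_rows m) (koszul_cols m) (koszul_entry m T)"

text \<open>
  The other types are type 210 after relabelling the factors, one for each of the six
  assignments of \<open>A\<close>, \<open>B\<close>, \<open>C\<close> to the three roles.
\<close>

definition satisfies_koszul :: "nat \<Rightarrow> tensor \<Rightarrow> bool" where
  "satisfies_koszul m T \<longleftrightarrow>
     koszul_210 m (\<lambda>(a, b, c). T (a, b, c)) \<and>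
     koszul_210 m (\<lambda>(a, c, b). T (a, b, c)) \<and>
     koszul_210 m (\<lambda>(b, a, c). T (a, b, c)) \<and>
     koszul_210 m (\<lambda>(b, c, a). T (a, b, c)) \<and>
     koszul_210 m (\<lambda>(c, a, b). T (a, b, c)) \<and>
     koszul_210 m (\<lambda>(c, b, a). T (a, b, c))"

end

theory Submission imports Defs begin

text \<open>
  Both systems of equations ask for enough elements in a kernel.  The Koszul flattening of type
  210 has rank at most \<open>m(m - 1)\<close> if and only if at least \<open>m\<close> independent matrices \<open>X \<in> A \<otimes> B\<^sup>*\<close>
  contract \<open>T\<close> to a tensor in \<open>S\<^sup>2A \<otimes> C\<close>.  For concise \<open>T\<close>, the 111-equations hold if and only if
  the 111-algebra, the space of triples of matrices \<open>(X, Y, Z)\<close> that have the same effect on \<open>T\<close>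
  when applied to the factors \<open>A\<close>, \<open>B\<close>, \<open>C\<close>, has dimension at least \<open>m\<close>.  The proof uses the
  implications \<open>koszul_210I\<close>, \<open>satisfies_111I\<close> and \<open>not_satisfies_111I\<close> between these conditions.

  A tensor with small 111-algebra and large Koszul kernels exists for \<open>m = 4\<close>: a \<open>W\<close>-tensor on
  the indices 0, 1 plus the cyclic orbit of \<open>a\<^sub>0b\<^sub>2c\<^sub>3\<close>.  Four explicit matrices lie in the kernel of
  its flattening of type 210, and symmetry transports them to the other types, but its
  111-algebra has dimension only 2.

  For the converse, let a commutative algebra of dimension \<open>m\<close> act faithfully on a module of
  dimension \<open>m\<close>.  The structure tensor satisfies the 111-equations, because the algebra embeds
  into the 111-algebra.  With the module argument as the distinguished factor, the kernel of the
  Koszul flattening consists of the linear maps \<open>\<psi>\<close> from the module to the algebra with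
  \<open>\<psi>(x)y = \<psi>(y)x\<close>, and nothing forces this space to have dimension \<open>m\<close>.  Let the algebra be the
  span of 1 and a square-zero ideal \<open>V\<close>, given by a space of linear maps from \<open>P\<close> to \<open>Q\<close> that acts
  on \<open>P \<oplus> Q\<close>.  If \<open>dim P \<ge> 2\<close> and no nonzero vector of \<open>V\<close> kills \<open>P\<close>, then \<open>\<psi>\<close> has values in \<open>V\<close>,
  vanishes on \<open>Q\<close>, and is subject to one equation in \<open>Q\<close> for each pair of basis vectors of \<open>P\<close>.
  For \<open>dim P = 3\<close>, \<open>dim Q = 4\<close> and \<open>dim V = 6\<close> there are 12 equations for 18 unknowns; when they are
  independent the kernel has dimension 6, less than \<open>m = 7\<close>.  The space \<open>V\<close> below is chosen so
  that a 43-minor is visibly diagonal.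
\<close>

section \<open>The dimension of the span of a finite family\<close>

text \<open>
  Each \<open>d \<in> D\<close> comes with a linear relation of the family in which \<open>F d\<close> is the only member of
  \<open>D\<close> that occurs, so \<open>F ` D\<close> is superfluous in the span.  Together with the next lemma this
  replaces rank-nullity for the map from coefficient vectors to linear combinations: relations
  with a prescribed set of pivots bound the rank from above, and their absence bounds it from
  below.
\<close>

lemma (in vector_space) dim_span_family_le:
  assumes J: "finite J" "D \<subseteq> J"
    and rel: "\<And>d. d \<in> D \<Longrightarrow>
      \<exists>c. (\<Sum>j\<in>J. scale (c j) (F j)) = 0 \<and> c d = 1 \<and> (\<forall>e\<in>D. e \<noteq> d \<longrightarrow> c e = 0)"
  shows "dim (span (F ` J)) \<le> card J - card D"
proof -
  have fin: "finite D" "finite (J - D)" using J finite_subset by auto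
  have elim: "F d \<in> span (F ` (J - D))" if d: "d \<in> D" for d
  proof -
    obtain c where c: "(\<Sum>j\<in>J. scale (c j) (F j)) = 0" "c d = 1" "\<forall>e\<in>D. e \<noteq> d \<longrightarrow> c e = 0"
      using rel[OF d] by blast
    have "(\<Sum>j\<in>J. scale (c j) (F j))
        = (\<Sum>j\<in>J - D. scale (c j) (F j)) + (\<Sum>j\<in>D. scale (c j) (F j))"
      using J by (rule sum.subset_diff[rotated])
    also have "(\<Sum>j\<in>D. scale (c j) (F j)) = (\<Sum>j\<in>D. if j = d then F d else 0)"
      using c by (intro sum.cong) auto
    also have "\<dots> = F d" using d fin by simp
    finally have "F d = - (\<Sum>j\<in>J - D. scale (c j) (F j))"
      using c(1) by (simp add: eq_neg_iff_add_eq_0 add.commute)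
    moreover have "- (\<Sum>j\<in>J - D. scale (c j) (F j)) \<in> span (F ` (J - D))"
      by (intro span_neg span_sum span_scale span_base imageI)
    ultimately show ?thesis by (simp only:)
  qed
  have "F ` J \<subseteq> span (F ` (J - D))"
    using elim by (auto intro: span_base)
  then have "span (F ` J) \<subseteq> span (F ` (J - D))"
    by (simp add: span_minimal)
  then have "dim (span (F ` J)) \<le> card (F ` (J - D))"
    by (rule dim_le_card) (use fin in auto)
  also have "\<dots> \<le> card (J - D)" using fin by (intro card_image_le)
  finally show ?thesis using J fin by (simp add: card_Diff_subset)
qed

lemma (in vector_space) dim_span_family_ge:
  assumes J: "finite J" "D \<subseteq> J"
    and triv: "\<And>c. (\<Sum>j\<in>J. scale (c j) (F j)) = 0 \<Longrightarrow> (\<And>d. d \<in> D \<Longrightarrow> c d = 0)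
      \<Longrightarrow> (\<And>j. j \<in> J \<Longrightarrow> c j = 0)"
  shows "card J - card D \<le> dim (span (F ` J))"
proof -
  define K where "K = J - D"
  have fin: "finite D" "finite K" using J finite_subset by (auto simp: K_def)
  have triv': "\<forall>j\<in>K. c j = 0" if c: "(\<Sum>j\<in>K. scale (c j) (F j)) = 0" for c
  proof -
    have ext: "(\<Sum>j\<in>J. scale (if j \<in> K then c j else 0) (F j)) = (\<Sum>j\<in>K. scale (c j) (F j))"
      using J by (intro sum.mono_neutral_cong_right) (auto simp: K_def)
    have "(if j \<in> K then c j else 0) = 0" if "j \<in> J" for j
      by (rule triv[of "\<lambda>j. if j \<in> K then c j else 0"])
        (use c that ext in \<open>auto simp: K_def\<close>)
    then show ?thesis by (force simp: K_def)
  qed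
  have inj: "inj_on F K"
  proof (rule inj_onI, rule ccontr)
    fix x y assume xy: "x \<in> K" "y \<in> K" "F x = F y" "x \<noteq> y"
    let ?c = "\<lambda>j. if j = x then 1 else if j = y then - 1 else 0"
    have "(\<Sum>j\<in>K. scale (?c j) (F j)) = (\<Sum>j\<in>{x, y}. scale (?c j) (F j))"
      using xy fin by (intro sum.mono_neutral_right) auto
    also have "\<dots> = 0" using xy by simp
    finally show False using triv'[of ?c] xy(1) by force
  qed
  have "independent (F ` K)"
  proof
    assume "dependent (F ` K)"
    then obtain u where u: "\<exists>v\<in>F ` K. u v \<noteq> 0" "(\<Sum>v\<in>F ` K. scale (u v) v) = 0"
      using dependent_finite[of "F ` K"] fin by auto
    have "(\<Sum>j\<in>K. scale (u (F j)) (F j)) = 0"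
      using u(2) inj by (simp add: sum.reindex)
    then show False using triv'[of "\<lambda>j. u (F j)"] u(1) by auto
  qed
  moreover obtain B where B: "B \<subseteq> span (F ` J)" "independent B" "span (F ` J) \<subseteq> span B"
      "card B = dim (span (F ` J))"
    using basis_exists by blast
  moreover have "finite B"
    using independent_span_bound[OF _ B(2) B(1)] J by simp
  moreover have "F ` K \<subseteq> span B"
    using B(3) span_superset[of "F ` J"] by (auto simp: K_def)
  ultimately have "card (F ` K) \<le> dim (span (F ` J))"
    using independent_span_bound[of B "F ` K"] by simp
  then show ?thesis using J fin inj by (simp add: card_image K_def card_Diff_subset)
qed

section \<open>Vanishing and non-vanishing minors\<close>

text \<open>
  Padding the fewer than \<open>d\<close> equations with zero rows gives a singular square matrix.
\<close>

lemma exists_nonzero_solution: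
  fixes a :: "'e \<Rightarrow> nat \<Rightarrow> 'a :: field"
  assumes N: "finite N" "card N < d"
  shows "\<exists>x. (\<exists>t<d. x t \<noteq> 0) \<and> (\<forall>e\<in>N. (\<Sum>t<d. x t * a e t) = 0)"
proof -
  obtain es where es: "set es = N" "distinct es"
    using N(1) finite_distinct_list by blast
  then have len: "length es < d" using N(2) by (metis distinct_card)
  define row where "row p = (if p = d - 1 then 0\<^sub>v d else
    vec d (\<lambda>t. if p < length es then a (es ! p) t else 0))" for p
  have carr: "mat\<^sub>r d d row \<in> carrier_mat d d" by simp
  have "det (mat\<^sub>r d d row) = 0"
    unfolding row_def using len by (intro det_row_0) auto
  then obtain v where v: "v \<in> carrier_vec d" "v \<noteq> 0\<^sub>v d" "mat\<^sub>r d d row *\<^sub>v v = 0\<^sub>v d"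
    using det_0_iff_vec_prod_zero[OF carr] by blast
  have "\<exists>t<d. v $ t \<noteq> 0"
    using v(1,2) by (metis carrier_vecD eq_vecI index_zero_vec)
  moreover have "(\<Sum>t<d. v $ t * a e t) = 0" if "e \<in> N" for e
  proof -
    have "e \<in> set es" using that es by simp
    then obtain p where p: "p < length es" "es ! p = e" by (auto simp: in_set_conv_nth)
    have "0 = (mat\<^sub>r d d row *\<^sub>v v) $ p" using v(3) p len by simp
    also have "\<dots> = row p \<bullet> v" using p len by (simp add: row_def)
    also have "\<dots> = (\<Sum>t<d. v $ t * a e t)"
      using v(1) p len
      by (auto simp: row_def scalar_prod_def lessThan_atLeast0 mult.commute intro!: sum.cong)
    finally show ?thesis by simp
  qed
  ultimately show ?thesis by blast
qed

text \<open>
  With \<open>d\<close> independent kernel vectors and fewer than \<open>d\<close> columns outside a chosen set of \<open>r\<close>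
  columns, some nonzero combination of the kernel vectors vanishes off the chosen columns, and
  so is a linear relation between the columns of every minor on them.  The pivots \<open>piv t\<close>
  witness the independence.
\<close>

lemma minors_vanish_if_kernel:
  assumes S: "finite S" "card S < r + d"
    and piv: "\<And>t. t < d \<Longrightarrow> piv t \<in> S"
      "\<And>t u. t < d \<Longrightarrow> u < d \<Longrightarrow> w t (piv u) = (if t = u then 1 else 0)"
    and ker: "\<And>t \<rho>. t < d \<Longrightarrow> \<rho> \<in> R \<Longrightarrow> (\<Sum>\<sigma>\<in>S. M \<rho> \<sigma> * w t \<sigma>) = 0"
  shows "minors_vanish r R S M"
  unfolding minors_vanish_def
proof (intro allI impI, elim conjE)
  fix rs cs
  assume rs: "distinct rs" "length rs = r" "set rs \<subseteq> R"
    and cs: "distinct cs" "length cs = r" "set cs \<subseteq> S"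
  define A where "A = mat r r (\<lambda>(p, q). M (rs ! p) (cs ! q))"
  have "r \<le> card S" using S cs by (metis card_mono distinct_card)
  then have cardN: "card (S - set cs) < d"
    using S cs by (simp add: card_Diff_subset distinct_card)
  obtain x where x: "\<exists>t<d. x t \<noteq> 0" "\<forall>\<sigma>\<in>S - set cs. (\<Sum>t<d. x t * w t \<sigma>) = 0"
    using exists_nonzero_solution[OF _ cardN, of "\<lambda>\<sigma> t. w t \<sigma>"] S by auto
  define y where "y \<sigma> = (\<Sum>t<d. x t * w t \<sigma>)" for \<sigma>
  have ypiv: "y (piv u) = x u" if "u < d" for u
  proof -
    have "y (piv u) = (\<Sum>t<d. if t = u then x t else 0)"
      unfolding y_def using piv(2) that by (intro sum.cong) auto
    then show ?thesis using that by simp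
  qed
  have ysupp: "\<sigma> \<in> set cs" if "\<sigma> \<in> S" "y \<sigma> \<noteq> 0" for \<sigma>
    using x(2) that by (auto simp: y_def)
  define v where "v = vec r (\<lambda>q. y (cs ! q))"
  obtain u where u: "u < d" "x u \<noteq> 0" using x(1) by blast
  then have "piv u \<in> set cs" using ysupp[of "piv u"] piv(1) ypiv by auto
  then obtain q where q: "q < r" "cs ! q = piv u" using cs(2) by (auto simp: in_set_conv_nth)
  then have "v $ q \<noteq> 0" using u ypiv by (simp add: v_def)
  then have nz: "v \<noteq> 0\<^sub>v r" using q by auto
  have "A *\<^sub>v v = 0\<^sub>v r"
  proof (rule eq_vecI)
    fix p assume "p < dim_vec (0\<^sub>v r :: complex vec)"
    then have p: "p < r" by simp
    then have inR: "rs ! p \<in> R" using rs nth_mem by fastforce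
    have "(A *\<^sub>v v) $ p = (\<Sum>q<length cs. M (rs ! p) (cs ! q) * y (cs ! q))"
      using p cs(2) by (simp add: A_def v_def scalar_prod_def lessThan_atLeast0)
    also have "\<dots> = (\<Sum>\<sigma>\<in>set cs. M (rs ! p) \<sigma> * y \<sigma>)"
      using sum.reindex_bij_betw[OF bij_betw_nth[OF cs(1) refl refl],
          of "\<lambda>\<sigma>. M (rs ! p) \<sigma> * y \<sigma>"] by simp
    also have "\<dots> = (\<Sum>\<sigma>\<in>S. M (rs ! p) \<sigma> * y \<sigma>)"
      using S cs ysupp by (intro sum.mono_neutral_left) auto
    also have "\<dots> = (\<Sum>t<d. x t * (\<Sum>\<sigma>\<in>S. M (rs ! p) \<sigma> * w t \<sigma>))"
      unfolding y_def sum_distrib_left by (subst sum.swap) (simp add: ac_simps)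
    also have "\<dots> = 0" using ker inR by simp
    finally show "(A *\<^sub>v v) $ p = 0\<^sub>v r $ p" using p by simp
  qed (simp add: A_def)
  then show "det A = 0"
    using det_0_iff_vec_prod_zero[of A r] nz unfolding A_def v_def
    by (metis mat_carrier vec_carrier)
qed

text \<open>
  The minor with columns \<open>S'\<close> and rows \<open>f ` S'\<close> is that of a diagonal matrix.
\<close>

lemma not_minors_vanish_if_diagonal:
  assumes S': "finite S'" "S' \<subseteq> S" "card S' = r"
    and f: "\<And>\<sigma>. \<sigma> \<in> S' \<Longrightarrow> f \<sigma> \<in> R"
    and diag: "\<And>\<sigma> \<tau>. \<sigma> \<in> S' \<Longrightarrow> \<tau> \<in> S' \<Longrightarrow> M (f \<sigma>) \<tau> \<noteq> 0 \<longleftrightarrow> \<sigma> = \<tau>"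
  shows "\<not> minors_vanish r R S M"
proof
  assume van: "minors_vanish r R S M"
  obtain cs where cs: "set cs = S'" "distinct cs"
    using S'(1) finite_distinct_list by blast
  then have len: "length cs = r" using S'(3) by (metis distinct_card)
  have "inj_on f S'" using diag by (intro inj_onI) metis
  then have "distinct (map f cs)" using cs by (simp add: distinct_map)
  moreover have "set (map f cs) \<subseteq> R" using f cs by auto
  ultimately have det0: "det (mat r r (\<lambda>(p, q). M (map f cs ! p) (cs ! q))) = 0"
    using van cs len S'(2) unfolding minors_vanish_def by (metis length_map)
  define A where "A = mat r r (\<lambda>(p, q). M (map f cs ! p) (cs ! q))"
  have entry: "A $$ (p, q) \<noteq> 0 \<longleftrightarrow> p = q" if "p < r" "q < r" for p q
    using that len cs diag[of "cs ! p" "cs ! q"]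
    by (auto simp: A_def nth_eq_iff_index_eq)
  have "det A = prod_list (diag_mat A)"
  proof (rule det_lower_triangular)
    show "A $$ (i, j) = 0" if "i < j" "j < r" for i j
      using entry[of i j] that by simp
  qed (simp add: A_def)
  moreover have "0 \<notin> set (diag_mat A)"
  proof
    assume "0 \<in> set (diag_mat A)"
    then obtain p where "p < r" "A $$ (p, p) = 0"
      by (auto simp: diag_mat_def A_def simp del: index_mat)
    then show False using entry by blast
  qed
  ultimately show False using det0 by (simp add: A_def[symmetric] prod_list_zero_iff)
qed

section \<open>The 111-equations in terms of triples of matrices\<close>

text \<open>
  A matrix acts on one factor of \<open>A \<otimes> B \<otimes> C\<close>.  The subspaces of the 111-equations are the sets
  \<open>{X \<cdot>\<^sub>A T}\<close>, \<open>{Y \<cdot>\<^sub>B T}\<close>, \<open>{Z \<cdot>\<^sub>C T}\<close> under all matrices, so that the equations are about the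
  space of triples \<open>(X, Y, Z)\<close> with \<open>X \<cdot>\<^sub>A T = Y \<cdot>\<^sub>B T = Z \<cdot>\<^sub>C T\<close>, known as the 111-algebra of \<open>T\<close>.
\<close>

definition act_A :: "nat \<Rightarrow> mtrx \<Rightarrow> tensor \<Rightarrow> tensor" where
  "act_A m X T = (\<lambda>(i, j, k). if i < m then \<Sum>s<m. X (i, s) * T (s, j, k) else 0)"

definition act_B :: "nat \<Rightarrow> mtrx \<Rightarrow> tensor \<Rightarrow> tensor" where
  "act_B m Y T = (\<lambda>(i, j, k). if j < m then \<Sum>s<m. Y (j, s) * T (i, s, k) else 0)"

definition act_C :: "nat \<Rightarrow> mtrx \<Rightarrow> tensor \<Rightarrow> tensor" where
  "act_C m Z T = (\<lambda>(i, j, k). if k < m then \<Sum>s<m. Z (k, s) * T (i, j, s) else 0)"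

lemmas act_defs = act_A_def act_B_def act_C_def

lemma act_add:
  "act_A m (X + X') T = act_A m X T + act_A m X' T"
  "act_B m (X + X') T = act_B m X T + act_B m X' T"
  "act_C m (X + X') T = act_C m X T + act_C m X' T"
  by (simp_all add: act_defs fun_eq_iff distrib_right sum.distrib)

lemma act_fscale:
  "act_A m (fscale c X) T = fscale c (act_A m X T)"
  "act_B m (fscale c X) T = fscale c (act_B m X T)"
  "act_C m (fscale c X) T = fscale c (act_C m X T)"
  by (simp_all add: act_defs fscale_def fun_eq_iff sum_distrib_left mult.assoc)

lemma act_0: "act_A m 0 T = 0" "act_B m 0 T = 0" "act_C m 0 T = 0"
  by (simp_all add: act_defs fun_eq_iff)

lemma sum_fun_apply: "(\<Sum>x\<in>I. f x) y = (\<Sum>x\<in>I. f x y)"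
  for f :: "'a \<Rightarrow> 'b \<Rightarrow> 'c :: comm_monoid_add"
  by (induction I rule: infinite_finite_induct) auto

lemma subspace_range:
  assumes "f 0 = 0" "\<And>x y. f (x + y) = f x + f y" "\<And>c x. f (fscale c x) = fscale c (f x)"
  shows "fn.subspace (range f)"
proof (rule fn.subspaceI)
  show "0 \<in> range f" by (rule range_eqI[where x = 0]) (simp add: assms(1))
  show "u + v \<in> range f" if "u \<in> range f" "v \<in> range f" for u v
    using that by (auto simp: assms(2)[symmetric])
  show "fscale c u \<in> range f" if "u \<in> range f" for c u
    using that by (auto simp: assms(3)[symmetric])
qed

text \<open>
  A product \<open>M \<otimes> a\<close> with \<open>M = T(\<alpha>)\<close> is the action of the rank-one matrix \<open>a \<otimes> \<alpha>\<close>; conversely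
  a matrix is the sum of its rows, each placed by a unit vector.  The same holds for \<open>B\<close> and \<open>C\<close>.
\<close>

lemma TA_A_eq: "TA_A m T = range (\<lambda>X. act_A m X T)"
proof
  show "TA_A m T \<subseteq> range (\<lambda>X. act_A m X T)"
    unfolding TA_A_def
  proof (rule fn.span_minimal)
    show "fn.subspace (range (\<lambda>X. act_A m X T))"
      by (rule subspace_range) (simp_all add: act_0 act_add act_fscale)
    have "(\<lambda>(i, j, k). flat_A m T \<alpha> (j, k) * a i)
        = act_A m (\<lambda>(i, s). a i * \<alpha> s) T" if "a \<in> vectors m" for \<alpha> a
      using that
      by (auto simp: fun_eq_iff flat_A_def act_A_def vectors_def sum_distrib_left sum_distrib_right
          ac_simps)
    then show "{(\<lambda>(i, j, k). M (j, k) * a i) | M a. M \<in> flat_A m T ` vectors m \<and> a \<in> vectors m}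
        \<subseteq> range (\<lambda>X. act_A m X T)"
      by auto
  qed
  show "range (\<lambda>X. act_A m X T) \<subseteq> TA_A m T"
  proof clarify
    fix X :: mtrx
    define \<alpha> where "\<alpha> t = (\<lambda>s. if s < m then X (t, s) else 0)" for t
    let ?gen = "\<lambda>t. (\<lambda>(i, j, k). flat_A m T (\<alpha> t) (j, k) * unit_vect t i)"
    have "act_A m X T = (\<Sum>t<m. ?gen t)"
      by (auto simp: fun_eq_iff sum_fun_apply act_A_def flat_A_def \<alpha>_def unit_vect_def
          if_distrib[of "\<lambda>x. _ * x"] cong: if_cong)
    moreover have "?gen t \<in> TA_A m T" if "t < m" for t
    proof -
      have "\<alpha> t \<in> vectors m" "unit_vect t \<in> vectors m"
        using that by (auto simp: \<alpha>_def unit_vect_def vectors_def)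
      then show ?thesis unfolding TA_A_def by (intro fn.span_base) blast
    qed
    ultimately show "act_A m X T \<in> TA_A m T"
      unfolding TA_A_def by (auto intro: fn.span_sum)
  qed
qed

lemma TB_B_eq: "TB_B m T = range (\<lambda>Y. act_B m Y T)"
proof
  show "TB_B m T \<subseteq> range (\<lambda>Y. act_B m Y T)"
    unfolding TB_B_def
  proof (rule fn.span_minimal)
    show "fn.subspace (range (\<lambda>Y. act_B m Y T))"
      by (rule subspace_range) (simp_all add: act_0 act_add act_fscale)
    have "(\<lambda>(i, j, k). flat_B m T \<beta> (i, k) * b j)
        = act_B m (\<lambda>(j, s). b j * \<beta> s) T" if "b \<in> vectors m" for \<beta> b
      using that
      by (auto simp: fun_eq_iff flat_B_def act_B_def vectors_def sum_distrib_left sum_distrib_right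
          ac_simps)
    then show "{(\<lambda>(i, j, k). M (i, k) * b j) | M b. M \<in> flat_B m T ` vectors m \<and> b \<in> vectors m}
        \<subseteq> range (\<lambda>Y. act_B m Y T)"
      by auto
  qed
  show "range (\<lambda>Y. act_B m Y T) \<subseteq> TB_B m T"
  proof clarify
    fix Y :: mtrx
    define \<beta> where "\<beta> t = (\<lambda>s. if s < m then Y (t, s) else 0)" for t
    let ?gen = "\<lambda>t. (\<lambda>(i, j, k). flat_B m T (\<beta> t) (i, k) * unit_vect t j)"
    have "act_B m Y T = (\<Sum>t<m. ?gen t)"
      by (auto simp: fun_eq_iff sum_fun_apply act_B_def flat_B_def \<beta>_def unit_vect_def
          if_distrib[of "\<lambda>x. _ * x"] cong: if_cong)
    moreover have "?gen t \<in> TB_B m T" if "t < m" for t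
    proof -
      have "\<beta> t \<in> vectors m" "unit_vect t \<in> vectors m"
        using that by (auto simp: \<beta>_def unit_vect_def vectors_def)
      then show ?thesis unfolding TB_B_def by (intro fn.span_base) blast
    qed
    ultimately show "act_B m Y T \<in> TB_B m T"
      unfolding TB_B_def by (auto intro: fn.span_sum)
  qed
qed

lemma TC_C_eq: "TC_C m T = range (\<lambda>Z. act_C m Z T)"
proof
  show "TC_C m T \<subseteq> range (\<lambda>Z. act_C m Z T)"
    unfolding TC_C_def
  proof (rule fn.span_minimal)
    show "fn.subspace (range (\<lambda>Z. act_C m Z T))"
      by (rule subspace_range) (simp_all add: act_0 act_add act_fscale)
    have "(\<lambda>(i, j, k). flat_C m T \<gamma> (i, j) * c k)
        = act_C m (\<lambda>(k, s). c k * \<gamma> s) T" if "c \<in> vectors m" for \<gamma> c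
      using that
      by (auto simp: fun_eq_iff flat_C_def act_C_def vectors_def sum_distrib_left sum_distrib_right
          ac_simps)
    then show "{(\<lambda>(i, j, k). M (i, j) * c k) | M c. M \<in> flat_C m T ` vectors m \<and> c \<in> vectors m}
        \<subseteq> range (\<lambda>Z. act_C m Z T)"
      by auto
  qed
  show "range (\<lambda>Z. act_C m Z T) \<subseteq> TC_C m T"
  proof clarify
    fix Z :: mtrx
    define \<gamma> where "\<gamma> t = (\<lambda>s. if s < m then Z (t, s) else 0)" for t
    let ?gen = "\<lambda>t. (\<lambda>(i, j, k). flat_C m T (\<gamma> t) (i, j) * unit_vect t k)"
    have "act_C m Z T = (\<Sum>t<m. ?gen t)"
      by (auto simp: fun_eq_iff sum_fun_apply act_C_def flat_C_def \<gamma>_def unit_vect_def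
          if_distrib[of "\<lambda>x. _ * x"] cong: if_cong)
    moreover have "?gen t \<in> TC_C m T" if "t < m" for t
    proof -
      have "\<gamma> t \<in> vectors m" "unit_vect t \<in> vectors m"
        using that by (auto simp: \<gamma>_def unit_vect_def vectors_def)
      then show ?thesis unfolding TC_C_def by (intro fn.span_base) blast
    qed
    ultimately show "act_C m Z T \<in> TC_C m T"
      unfolding TC_C_def by (auto intro: fn.span_sum)
  qed
qed

text \<open>
  The coordinates of a triple \<open>(X, Y, Z)\<close> are indexed by a factor and a position in the
  corresponding matrix.
\<close>

datatype factor = FA | FB | FC

lemma UNIV_factor: "(UNIV :: factor set) = {FA, FB, FC}"
  by (auto intro: factor.exhaust)

definition map_act :: "nat \<Rightarrow> tensor \<Rightarrow> mtrx \<times> mtrx \<times> mtrx \<Rightarrow> tensor \<times> tensor" where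
  "map_act m T = (\<lambda>(X, Y, Z). map_111 (act_A m X T, act_B m Y T, act_C m Z T))"

definition grid :: "nat \<Rightarrow> (factor \<times> nat \<times> nat) set" where
  "grid m = UNIV \<times> {..<m} \<times> {..<m}"

definition unit_mtrx :: "nat \<times> nat \<Rightarrow> mtrx" where
  "unit_mtrx p = (\<lambda>q. if q = p then 1 else 0)"

definition unit_image :: "nat \<Rightarrow> tensor \<Rightarrow> factor \<times> nat \<times> nat \<Rightarrow> tensor \<times> tensor" where
  "unit_image m T = (\<lambda>(f, p). map_act m T
     (case f of FA \<Rightarrow> (unit_mtrx p, 0, 0) | FB \<Rightarrow> (0, unit_mtrx p, 0) | FC \<Rightarrow> (0, 0, unit_mtrx p)))"

lemma finite_grid: "finite (grid m)"
  by (simp add: grid_def UNIV_factor)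

lemma card_grid: "card (grid m) = 3 * m\<^sup>2"
  by (simp add: grid_def UNIV_factor card_cartesian_product power2_eq_square)

lemma act_sum_units:
  "act_A m X T = (\<Sum>p\<in>{..<m} \<times> {..<m}. fscale (X p) (act_A m (unit_mtrx p) T))"
  "act_B m X T = (\<Sum>p\<in>{..<m} \<times> {..<m}. fscale (X p) (act_B m (unit_mtrx p) T))"
  "act_C m X T = (\<Sum>p\<in>{..<m} \<times> {..<m}. fscale (X p) (act_C m (unit_mtrx p) T))"
proof -
  have unit: "(\<Sum>s<m. unit_mtrx (t, u) (i, s) * f s) = (if i = t \<and> u < m then f u else 0)"
    for t u i :: nat and f :: "nat \<Rightarrow> complex"
    by (auto simp: unit_mtrx_def if_distrib[of "\<lambda>x. x * _"] cong: if_cong)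
  have double: "(\<Sum>t<m. \<Sum>u<m. X (t, u) * (if i = t then f u else 0)) = (\<Sum>s<m. X (i, s) * f s)"
    if "i < m" for i and f :: "nat \<Rightarrow> complex"
  proof -
    have "(\<Sum>t<m. \<Sum>u<m. X (t, u) * (if i = t then f u else 0))
      = (\<Sum>t<m. if i = t then \<Sum>u<m. X (t, u) * f u else 0)"
      by (intro sum.cong) auto
    then show ?thesis using that by simp
  qed
  show "act_A m X T = (\<Sum>p\<in>{..<m} \<times> {..<m}. fscale (X p) (act_A m (unit_mtrx p) T))"
    by (simp add: fun_eq_iff sum_fun_apply fscale_def act_A_def unit double sum.cartesian_product'
        cong: if_cong)
  show "act_B m X T = (\<Sum>p\<in>{..<m} \<times> {..<m}. fscale (X p) (act_B m (unit_mtrx p) T))"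
    by (simp add: fun_eq_iff sum_fun_apply fscale_def act_B_def unit double sum.cartesian_product'
        cong: if_cong)
  show "act_C m X T = (\<Sum>p\<in>{..<m} \<times> {..<m}. fscale (X p) (act_C m (unit_mtrx p) T))"
    by (simp add: fun_eq_iff sum_fun_apply fscale_def act_C_def unit double sum.cartesian_product'
        cong: if_cong)
qed

lemma map_act_sum_units:
  "map_act m T (\<lambda>p. c (FA, p), \<lambda>p. c (FB, p), \<lambda>p. c (FC, p))
    = (\<Sum>j\<in>grid m. pscale (c j) (unit_image m T j))"
proof -
  let ?G = "{..<m} \<times> {..<m}"
  have "(\<Sum>j\<in>grid m. pscale (c j) (unit_image m T j))
      = (\<Sum>p\<in>?G. pscale (c (FA, p)) (unit_image m T (FA, p)))
      + ((\<Sum>p\<in>?G. pscale (c (FB, p)) (unit_image m T (FB, p)))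
      + (\<Sum>p\<in>?G. pscale (c (FC, p)) (unit_image m T (FC, p))))"
    unfolding grid_def UNIV_factor
    by (simp only: sum.cartesian_product'[of _ "{FA, FB, FC}" ?G]) simp
  also have "\<dots> = map_act m T (\<lambda>p. c (FA, p), \<lambda>p. c (FB, p), \<lambda>p. c (FC, p))"
    unfolding map_act_def map_111_def prod.case act_sum_units[of m "\<lambda>p. c (_, p)"]
    by (simp add: prod_eq_iff fst_sum snd_sum unit_image_def map_act_def map_111_def pscale_def
        act_0 sum_negf fn.scale_minus_right)
  finally show ?thesis by simp
qed

text \<open>
  The image in the 111-equations is spanned by the \<open>3m\<^sup>2\<close> images of the matrix units, and by
  \<open>map_act_sum_units\<close> the linear relations between these are the triples that \<open>map_act\<close> kills.
\<close>

lemma image_map_111_eq: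
  "map_111 ` (TA_A m T \<times> TB_B m T \<times> TC_C m T) = fnpair.span (unit_image m T ` grid m)"
proof -
  have img: "map_111 ` (TA_A m T \<times> TB_B m T \<times> TC_C m T) = range (map_act m T)"
  proof (intro equalityI subsetI)
    fix w assume "w \<in> map_111 ` (TA_A m T \<times> TB_B m T \<times> TC_C m T)"
    then obtain X Y Z where "w = map_111 (act_A m X T, act_B m Y T, act_C m Z T)"
      unfolding TA_A_eq TB_B_eq TC_C_eq by blast
    then have "w = map_act m T (X, Y, Z)" by (simp add: map_act_def)
    then show "w \<in> range (map_act m T)" by (rule range_eqI)
  next
    fix w assume "w \<in> range (map_act m T)"
    then show "w \<in> map_111 ` (TA_A m T \<times> TB_B m T \<times> TC_C m T)"
      unfolding TA_A_eq TB_B_eq TC_C_eq by (auto simp: map_act_def)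
  qed
  have "map_act m T (X, Y, Z) \<in> fnpair.span (unit_image m T ` grid m)" for X Y Z
  proof -
    let ?c = "\<lambda>(f, p). (case f of FA \<Rightarrow> X | FB \<Rightarrow> Y | FC \<Rightarrow> Z) p"
    have "map_act m T (X, Y, Z) = (\<Sum>j\<in>grid m. pscale (?c j) (unit_image m T j))"
      using map_act_sum_units[of m T ?c] by simp
    moreover have "(\<Sum>j\<in>grid m. pscale (?c j) (unit_image m T j))
        \<in> fnpair.span (unit_image m T ` grid m)"
      by (intro fnpair.span_sum fnpair.span_scale fnpair.span_base imageI)
    ultimately show ?thesis by (simp only:)
  qed
  moreover have "fnpair.subspace (range (map_act m T))"
  proof (rule fnpair.subspaceI)
    have "map_act m T (0, 0, 0) = 0"
      by (simp add: map_act_def map_111_def act_0 zero_prod_def)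
    then show "0 \<in> range (map_act m T)" by (metis rangeI)
    have "map_act m T (X, Y, Z) + map_act m T (X', Y', Z') = map_act m T (X + X', Y + Y', Z + Z')"
      for X Y Z X' Y' Z'
      by (simp add: map_act_def map_111_def act_add)
    then show "x + y \<in> range (map_act m T)"
      if "x \<in> range (map_act m T)" "y \<in> range (map_act m T)" for x y
      using that by auto
    have "pscale c (map_act m T (X, Y, Z)) = map_act m T (fscale c X, fscale c Y, fscale c Z)"
      for c X Y Z
      by (simp add: map_act_def map_111_def act_fscale pscale_def fn.scale_right_diff_distrib)
    then show "pscale c x \<in> range (map_act m T)" if "x \<in> range (map_act m T)" for c x
      using that by auto
  qed
  then have "fnpair.span (unit_image m T ` grid m) \<subseteq> range (map_act m T)"
    by (intro fnpair.span_minimal) (auto simp: unit_image_def)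
  ultimately show ?thesis unfolding img by auto
qed

lemma map_act_eq_0_iff:
  "map_act m T (X, Y, Z) = 0 \<longleftrightarrow> act_A m X T = act_B m Y T \<and> act_B m Y T = act_C m Z T"
  by (simp add: map_act_def map_111_def zero_prod_def)

text \<open>
  If the 111-algebra has \<open>m\<close> linearly independent elements, then the map of the 111-equations
  loses \<open>m\<close> dimensions.  Independence is read off at \<open>m\<close> positions of the matrices \<open>X\<close>.
\<close>

lemma satisfies_111I:
  assumes eq: "\<And>r. r < m \<Longrightarrow> act_A m (X r) T = act_B m (Y r) T"
      "\<And>r. r < m \<Longrightarrow> act_B m (Y r) T = act_C m (Z r) T"
    and piv: "\<And>r. r < m \<Longrightarrow> piv r \<in> {..<m} \<times> {..<m}"
      "\<And>r s. r < m \<Longrightarrow> s < m \<Longrightarrow> X r (piv s) = (if r = s then 1 else 0)"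
  shows "satisfies_111 m T"
proof -
  let ?D = "(\<lambda>r. (FA, piv r)) ` {..<m}"
  have D: "?D \<subseteq> grid m" using piv(1) unfolding grid_def by blast
  have "inj_on (\<lambda>r. (FA, piv r)) {..<m}"
  proof (rule inj_onI)
    fix r s assume "r \<in> {..<m}" "s \<in> {..<m}" "(FA, piv r) = (FA, piv s)"
    then show "r = s" using piv(2)[of r r] piv(2)[of r s] by (auto split: if_splits)
  qed
  then have card: "card ?D = m" by (simp add: card_image)
  have "fnpair.dim (fnpair.span (unit_image m T ` grid m)) \<le> card (grid m) - card ?D"
  proof (rule fnpair.dim_span_family_le[OF finite_grid D])
    fix d assume "d \<in> ?D"
    then obtain r where r: "r < m" "d = (FA, piv r)" by auto
    let ?c = "\<lambda>(f, p). (case f of FA \<Rightarrow> X r | FB \<Rightarrow> Y r | FC \<Rightarrow> Z r) p"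
    have "(\<Sum>j\<in>grid m. pscale (?c j) (unit_image m T j)) = 0"
      using map_act_sum_units[of m T ?c] map_act_eq_0_iff[of m T "X r" "Y r" "Z r"] eq r(1)
      by simp
    moreover have "?c d = 1" "\<forall>e\<in>?D. e \<noteq> d \<longrightarrow> ?c e = 0" using r piv(2) by auto
    ultimately show "\<exists>c. (\<Sum>j\<in>grid m. pscale (c j) (unit_image m T j)) = 0 \<and> c d = 1
        \<and> (\<forall>e\<in>?D. e \<noteq> d \<longrightarrow> c e = 0)"
      by blast
  qed
  then show ?thesis
    by (simp add: satisfies_111_def image_map_111_eq card card_grid)
qed

text \<open>
  If a triple in the 111-algebra is determined by the fewer than \<open>m\<close> entries of \<open>X\<close> at the
  positions \<open>D\<close>, then the map of the 111-equations loses fewer than \<open>m\<close> dimensions.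
\<close>

lemma not_satisfies_111I:
  assumes D: "D \<subseteq> {..<m} \<times> {..<m}" "card D < m"
    and triv: "\<And>X Y Z. act_A m X T = act_B m Y T \<Longrightarrow> act_B m Y T = act_C m Z T
      \<Longrightarrow> (\<And>p. p \<in> D \<Longrightarrow> X p = 0)
      \<Longrightarrow> (\<And>p. p \<in> {..<m} \<times> {..<m} \<Longrightarrow> X p = 0 \<and> Y p = 0 \<and> Z p = 0)"
  shows "\<not> satisfies_111 m T"
proof -
  let ?D = "Pair FA ` D"
  have D': "?D \<subseteq> grid m" using D(1) by (auto simp: grid_def)
  have card: "card ?D = card D" by (simp add: card_image inj_on_def)
  have "card (grid m) - card ?D \<le> fnpair.dim (fnpair.span (unit_image m T ` grid m))"
  proof (rule fnpair.dim_span_family_ge[OF finite_grid D'])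
    fix c j assume c: "(\<Sum>j\<in>grid m. pscale (c j) (unit_image m T j)) = 0"
      "\<And>d. d \<in> ?D \<Longrightarrow> c d = 0" and j: "j \<in> grid m"
    have "map_act m T (\<lambda>p. c (FA, p), \<lambda>p. c (FB, p), \<lambda>p. c (FC, p)) = 0"
      using c(1) map_act_sum_units[of m T c] by simp
    then have "c (FA, p) = 0 \<and> c (FB, p) = 0 \<and> c (FC, p) = 0" if "p \<in> {..<m} \<times> {..<m}" for p
      using triv[of "\<lambda>p. c (FA, p)" "\<lambda>p. c (FB, p)" "\<lambda>p. c (FC, p)" p] c(2) that
      unfolding map_act_eq_0_iff by blast
    then show "c j = 0" using j by (cases j; cases "fst j") (auto simp: grid_def)
  qed
  moreover have "m \<le> 3 * m\<^sup>2" by (simp add: power2_eq_square)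
  ultimately show ?thesis
    using D(2) by (simp add: satisfies_111_def image_map_111_eq card card_grid)
qed

section \<open>Conciseness\<close>

lemma inj_on_vectors:
  assumes "\<And>i. i < m \<Longrightarrow> \<exists>x a. a \<noteq> 0 \<and> (\<forall>v. f v x = a * v i)"
  shows "inj_on f (vectors m)"
proof (rule inj_onI)
  fix v w assume vw: "v \<in> vectors m" "w \<in> vectors m" "f v = f w"
  show "v = w"
  proof
    fix i show "v i = w i"
    proof (cases "i < m")
      case True
      then obtain x a where "a \<noteq> 0" "\<forall>v. f v x = a * v i" using assms by blast
      then show ?thesis using vw(3) by (metis mult_left_cancel)
    qed (use vw in \<open>simp add: vectors_def\<close>)
  qed
qed

lemma sum_single:
  fixes g :: "nat \<Rightarrow> complex"
  assumes "i < m" "\<And>s. s < m \<Longrightarrow> s \<noteq> i \<Longrightarrow> g s = 0"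
  shows "(\<Sum>s<m. v s * g s) = g i * v i"
proof -
  have "(\<Sum>s<m. v s * g s) = (\<Sum>s\<in>{i}. v s * g s)"
    using assms by (intro sum.mono_neutral_right) auto
  then show ?thesis by simp
qed

text \<open>
  A slice with a nonzero entry where all parallel slices vanish reveals its coefficient in every
  linear combination of the slices.
\<close>

lemma conciseI:
  assumes A: "\<And>i. i < m \<Longrightarrow> \<exists>j k. T (i, j, k) \<noteq> 0 \<and> (\<forall>s<m. s \<noteq> i \<longrightarrow> T (s, j, k) = 0)"
    and B: "\<And>j. j < m \<Longrightarrow> \<exists>i k. T (i, j, k) \<noteq> 0 \<and> (\<forall>s<m. s \<noteq> j \<longrightarrow> T (i, s, k) = 0)"
    and C: "\<And>k. k < m \<Longrightarrow> \<exists>i j. T (i, j, k) \<noteq> 0 \<and> (\<forall>s<m. s \<noteq> k \<longrightarrow> T (i, j, s) = 0)"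
  shows "concise m T"
  unfolding concise_def
proof (intro conjI inj_on_vectors)
  fix i assume i: "i < m"
  obtain j k where jk: "T (i, j, k) \<noteq> 0" "\<forall>s<m. s \<noteq> i \<longrightarrow> T (s, j, k) = 0" using A[OF i] by blast
  have "flat_A m T v (j, k) = T (i, j, k) * v i" for v
    using sum_single[of i m "\<lambda>s. T (s, j, k)"] i jk(2) by (simp add: flat_A_def)
  then show "\<exists>x a. a \<noteq> 0 \<and> (\<forall>v. flat_A m T v x = a * v i)" using jk(1) by blast
next
  fix j assume j: "j < m"
  obtain i k where ik: "T (i, j, k) \<noteq> 0" "\<forall>s<m. s \<noteq> j \<longrightarrow> T (i, s, k) = 0" using B[OF j] by blast
  have "flat_B m T v (i, k) = T (i, j, k) * v j" for v
    using sum_single[of j m "\<lambda>s. T (i, s, k)"] j ik(2) by (simp add: flat_B_def)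
  then show "\<exists>x a. a \<noteq> 0 \<and> (\<forall>v. flat_B m T v x = a * v j)" using ik(1) by blast
next
  fix k assume k: "k < m"
  obtain i j where ij: "T (i, j, k) \<noteq> 0" "\<forall>s<m. s \<noteq> k \<longrightarrow> T (i, j, s) = 0" using C[OF k] by blast
  have "flat_C m T v (i, j) = T (i, j, k) * v k" for v
    using sum_single[of k m "\<lambda>s. T (i, j, s)"] k ij(2) by (simp add: flat_C_def)
  then show "\<exists>x a. a \<noteq> 0 \<and> (\<forall>v. flat_C m T v x = a * v k)" using ij(1) by blast
qed

section \<open>The Koszul flattening as a symmetry condition\<close>

lemma koszul_entry_eq:
  assumes "s < m" "t < m" "l < m" "j < m"
  shows "koszul_entry m T ((s, t), l) (i, j)
    = (if i = s then T (t, j, l) else 0) - (if i = t then T (s, j, l) else 0)"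
proof -
  have "koszul_entry m T ((s, t), l) (i, j)
      = (\<Sum>i'<m. T (i', j, l) * wedge (unit_vect i) (unit_vect i') (s, t))"
    using assms
    by (simp add: koszul_entry_def koszul_map_def unit_vect_def
        if_distrib[of "\<lambda>x. _ * x"] if_distrib[of "\<lambda>x. x * _"] cong: if_cong)
  also have "\<dots> = (\<Sum>i'<m. (if i' = t then if i = s then T (t, j, l) else 0 else 0)
      - (if i' = s then if i = t then T (s, j, l) else 0 else 0))"
    by (intro sum.cong) (auto simp: wedge_def unit_vect_def)
  finally show ?thesis
    using assms by (simp add: sum_subtractf)
qed

text \<open>
  A matrix \<open>X\<close>, as an element of \<open>A \<otimes> B\<^sup>*\<close>, lies in the kernel of the Koszul flattening if and only
  if contracting \<open>B\<close> with it turns \<open>T\<close> into an element of \<open>S\<^sup>2A \<otimes> C\<close>.  The source has dimension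
  \<open>m\<^sup>2 = m(m - 1) + m\<close>, so \<open>m\<close> independent elements of the kernel make the rank at most \<open>m(m - 1)\<close>.
\<close>

lemma koszul_210I:
  assumes sym: "\<And>r i l s. r < m \<Longrightarrow> i < m \<Longrightarrow> s < m \<Longrightarrow> l < m \<Longrightarrow>
      (\<Sum>j<m. X r (s, j) * T (i, j, l)) = (\<Sum>j<m. X r (i, j) * T (s, j, l))"
    and piv: "\<And>r. r < m \<Longrightarrow> piv r \<in> {..<m} \<times> {..<m}"
      "\<And>r s. r < m \<Longrightarrow> s < m \<Longrightarrow> X r (piv s) = (if r = s then 1 else 0)"
  shows "koszul_210 m T"
  unfolding koszul_210_def
proof (rule minors_vanish_if_kernel[where d = m and piv = piv and w = X])
  show "finite (koszul_cols m)" by (simp add: koszul_cols_def)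
  show "card (koszul_cols m) < m * (m - 1) + 1 + m"
    by (cases m) (simp_all add: koszul_cols_def card_cartesian_product)
  show "piv r \<in> koszul_cols m" if "r < m" for r using piv(1) that by (simp add: koszul_cols_def)
  show "(\<Sum>\<sigma>\<in>koszul_cols m. koszul_entry m T \<rho> \<sigma> * X r \<sigma>) = 0"
    if r: "r < m" and row: "\<rho> \<in> koszul_rows m" for r \<rho>
  proof -
    obtain s t l where \<rho>: "\<rho> = ((s, t), l)" "s < m" "t < m" "l < m"
      using row by (auto simp: koszul_rows_def)
    have "(\<Sum>\<sigma>\<in>koszul_cols m. koszul_entry m T \<rho> \<sigma> * X r \<sigma>)
      = (\<Sum>i<m. \<Sum>j<m. (if i = s then X r (s, j) * T (t, j, l) else 0)
          - (if i = t then X r (t, j) * T (s, j, l) else 0))"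
      unfolding koszul_cols_def sum.cartesian_product'
      using \<rho> by (intro sum.cong) (auto simp: koszul_entry_eq)
    also have "\<dots> = (\<Sum>j<m. X r (s, j) * T (t, j, l)) - (\<Sum>j<m. X r (t, j) * T (s, j, l))"
      by (subst sum.swap) (use \<rho> in \<open>simp add: sum_subtractf\<close>)
    finally show ?thesis using sym[OF r] \<rho> by simp
  qed
qed (use piv in auto)

section \<open>A tensor satisfying the Koszul but not the 111-equations\<close>

text \<open>
  The sum of the \<open>W\<close>-tensor \<open>a\<^sub>0b\<^sub>0c\<^sub>1 + a\<^sub>0b\<^sub>1c\<^sub>0 + a\<^sub>1b\<^sub>0c\<^sub>0\<close> and the cyclic orbit of \<open>a\<^sub>0b\<^sub>pc\<^sub>q\<close>; for
  \<open>m = 4\<close> the indices \<open>p\<close> and \<open>q\<close> are 2 and 3.  Cyclic permutations of the factors fix it and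
  transpositions exchange \<open>p\<close> and \<open>q\<close>, which is why both orders are considered.
\<close>

definition cyclic_tensor :: "nat \<Rightarrow> nat \<Rightarrow> tensor" where
  "cyclic_tensor p q = (\<lambda>x. of_bool
     (x \<in> {(0, 0, 1), (0, 1, 0), (1, 0, 0), (0, p, q), (p, q, 0), (q, 0, p)}))"



lemma all_less_4: "(\<forall>i<4. P i) \<longleftrightarrow> P 0 \<and> P 1 \<and> P 2 \<and> P (3 :: nat)"
  by (auto simp: numeral_eq_Suc less_Suc_eq)

lemma sum_less_4: "(\<Sum>i<(4 :: nat). f i) = f 0 + f 1 + f 2 + (f 3 :: complex)"
  by (simp add: eval_nat_numeral)

text \<open>
  A basis of the kernel of the Koszul flattening of \<open>cyclic_tensor p q\<close>, as 0-1 matrices given by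
  their supports.
\<close>

definition cyclic_kernel :: "nat \<Rightarrow> nat \<Rightarrow> nat \<Rightarrow> mtrx" where
  "cyclic_kernel p q r = (\<lambda>x. of_bool
     (x \<in> [{(0, 1)}, {(0, p)}, {(p, q)}, {(0, q), (p, 1)}] ! r))"

lemma koszul_210_cyclic_tensor:
  assumes "(p, q) \<in> {(2, 3), (3, 2)}"
  shows "koszul_210 4 (cyclic_tensor p q)"
proof (rule koszul_210I)
  let ?piv = "\<lambda>r. [(0, 1), (0, p), (p, q), (0, q)] ! r"
  have slice: "cyclic_tensor p q (i, 0, l) = of_bool ((i, l) \<in> {(0, 1), (1, 0), (q, p)})"
    "cyclic_tensor p q (i, Suc 0, l) = of_bool (i = 0 \<and> l = 0)"
    "cyclic_tensor p q (i, p, l) = of_bool (i = 0 \<and> l = q)"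
    "cyclic_tensor p q (i, q, l) = of_bool (i = p \<and> l = 0)" for i l
    using assms by (auto simp: cyclic_tensor_def)
  have sum: "(\<Sum>j<4. f j) = f 0 + f 1 + f p + f q" for f :: "nat \<Rightarrow> complex"
    using assms by (auto simp: sum_less_4)
  have ker: "cyclic_kernel p q 0 (s, j) = of_bool (s = 0) * of_bool (j = 1)"
    "cyclic_kernel p q 1 (s, j) = of_bool (s = 0) * of_bool (j = p)"
    "cyclic_kernel p q 2 (s, j) = of_bool (s = p) * of_bool (j = q)"
    "cyclic_kernel p q 3 (s, j) = of_bool (s = 0) * of_bool (j = q) + of_bool (s = p) * of_bool (j = 1)"
    for s j
    using assms by (auto simp: cyclic_kernel_def)
  have dist: "p \<noteq> 0" "q \<noteq> 0" "p \<noteq> Suc 0" "q \<noteq> Suc 0" "p \<noteq> q" "q \<noteq> p"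
    using assms by auto
  have "\<forall>r<4. (\<Sum>j<4. cyclic_kernel p q r (s, j) * cyclic_tensor p q (i, j, l))
      = (\<Sum>j<4. cyclic_kernel p q r (i, j) * cyclic_tensor p q (s, j, l))" for i s l
    unfolding all_less_4 sum ker by (simp add: dist dist[symmetric] slice of_bool_conj)
  then show "(\<Sum>j<4. cyclic_kernel p q r (s, j) * cyclic_tensor p q (i, j, l))
      = (\<Sum>j<4. cyclic_kernel p q r (i, j) * cyclic_tensor p q (s, j, l))"
    if "r < 4" "i < 4" "s < 4" "l < 4" for r i l s using that by blast
  have "\<forall>r<4. ?piv r \<in> {..<4} \<times> {..<4}"
    using assms unfolding all_less_4 by auto
  then show "?piv r \<in> {..<4} \<times> {..<4}" if "r < 4" for r using that by blast
  have "\<forall>r<4. \<forall>s<4. cyclic_kernel p q r (?piv s) = (if r = s then 1 else 0)"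
    using assms unfolding all_less_4 by (auto simp: cyclic_kernel_def)
  then show "cyclic_kernel p q r (?piv s) = (if r = s then 1 else 0)" if "r < 4" "s < 4" for r s
    using that by blast
qed

lemma satisfies_koszul_cyclic_tensor: "satisfies_koszul 4 (cyclic_tensor 2 3)"
proof -
  have "(\<lambda>(a, b, c). cyclic_tensor 2 3 (a, b, c)) = cyclic_tensor 2 3"
    "(\<lambda>(b, c, a). cyclic_tensor 2 3 (a, b, c)) = cyclic_tensor 2 3"
    "(\<lambda>(c, a, b). cyclic_tensor 2 3 (a, b, c)) = cyclic_tensor 2 3"
    "(\<lambda>(a, c, b). cyclic_tensor 2 3 (a, b, c)) = cyclic_tensor 3 2"
    "(\<lambda>(b, a, c). cyclic_tensor 2 3 (a, b, c)) = cyclic_tensor 3 2"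
    "(\<lambda>(c, b, a). cyclic_tensor 2 3 (a, b, c)) = cyclic_tensor 3 2"
    by (auto simp: fun_eq_iff cyclic_tensor_def)
  then show ?thesis
    unfolding satisfies_koszul_def by (simp add: koszul_210_cyclic_tensor)
qed

lemma concise_cyclic_tensor: "concise 4 (cyclic_tensor 2 3)"
proof (rule conciseI)
  let ?T = "cyclic_tensor 2 3"
  let ?pos = "\<lambda>i. [(0, 1), (0, 0), (3, 0), (0, 2)] ! i"
  have "\<forall>i<4. ?T (i, ?pos i) \<noteq> 0 \<and> (\<forall>s<4. s \<noteq> i \<longrightarrow> ?T (s, ?pos i) = 0)"
    unfolding all_less_4 by (auto simp: cyclic_tensor_def)
  then have A: "\<exists>a b. ?T (j, a, b) \<noteq> 0 \<and> (\<forall>s<4. s \<noteq> j \<longrightarrow> ?T (s, a, b) = 0)" if "j < 4" for j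
    using that by (metis surj_pair)
  then show "\<exists>a b. ?T (j, a, b) \<noteq> 0 \<and> (\<forall>s<4. s \<noteq> j \<longrightarrow> ?T (s, a, b) = 0)" if "j < 4" for j
    using that .
  have "?T (b, s, a) = ?T (s, a, b)" "?T (a, b, s) = ?T (s, a, b)" for s a b
    by (auto simp: cyclic_tensor_def)
  then show "\<exists>b a. ?T (b, j, a) \<noteq> 0 \<and> (\<forall>s<4. s \<noteq> j \<longrightarrow> ?T (b, s, a) = 0)"
    "\<exists>a b. ?T (a, b, j) \<noteq> 0 \<and> (\<forall>s<4. s \<noteq> j \<longrightarrow> ?T (a, b, s) = 0)" if "j < 4" for j
    using A[OF that] by (metis (no_types))+
qed

text \<open>
  Acting on one factor changes one index of a monomial and keeps the other two, so a monomial
  \<open>a\<^sub>ib\<^sub>jc\<^sub>k\<close> can occur in all three spaces only if each two of its indices occur in the same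
  positions in a monomial of \<open>T\<close>.  Comparing the coefficients of the monomials in
  \<open>X \<cdot>\<^sub>A T = Y \<cdot>\<^sub>B T = Z \<cdot>\<^sub>C T\<close> leaves only the multiples of \<open>T\<close> itself, with coefficient \<open>X (0, 0)\<close>,
  and of \<open>a\<^sub>0b\<^sub>0c\<^sub>0\<close>, with coefficient \<open>X (0, 1)\<close>: the 111-algebra has dimension 2, less than 4.
\<close>

lemma not_satisfies_111_cyclic_tensor: "\<not> satisfies_111 4 (cyclic_tensor 2 3)"
proof (rule not_satisfies_111I)
  let ?T = "cyclic_tensor 2 3"
  \<comment> \<open>the entries of \<open>X\<close> that determine the whole triple\<close>
  let ?D = "{(0, 0), (0, 1)} :: (nat \<times> nat) set"
  show "?D \<subseteq> {..<4} \<times> {..<4}" "card ?D < 4" by auto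
  fix X Y Z :: mtrx and x :: "nat \<times> nat"
  assume eq: "act_A 4 X ?T = act_B 4 Y ?T" "act_B 4 Y ?T = act_C 4 Z ?T"
    and D: "\<And>x. x \<in> ?D \<Longrightarrow> X x = 0" and x: "x \<in> {..<4} \<times> {..<4}"
  have "\<forall>i<4. \<forall>j<4. \<forall>k<4. act_A 4 X ?T (i, j, k) = act_B 4 Y ?T (i, j, k)"
    "\<forall>i<4. \<forall>j<4. \<forall>k<4. act_B 4 Y ?T (i, j, k) = act_C 4 Z ?T (i, j, k)"
    using eq by simp_all
  moreover have "X (0, 0) = 0" "X (0, 1) = 0" using D by auto
  ultimately have "\<forall>i<4. \<forall>j<4. X (i, j) = 0 \<and> Y (i, j) = 0 \<and> Z (i, j) = 0"
    unfolding all_less_4 act_defs sum_less_4 prod.case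
    by (simp add: cyclic_tensor_def)
  then show "X x = 0 \<and> Y x = 0 \<and> Z x = 0" using x by auto
qed

section \<open>A tensor satisfying the 111- but not the Koszul equations\<close>

text \<open>
  The structure tensor of a module.  The algebra has basis \<open>1\<close> (index 0) and \<open>v\<^sub>j\<^sub>s\<close> (index
  \<open>1 + j + 3s\<close>) for \<open>j < 3\<close>, \<open>s < 2\<close>, where all products of two \<open>v\<close>'s are 0.  The module has basis
  \<open>p\<^sub>0, p\<^sub>1, p\<^sub>2\<close> (indices 0, 1, 2), \<open>q\<^sub>0, q\<^sub>1\<close> (indices 3, 4) and \<open>q'\<^sub>0, q'\<^sub>1\<close> (indices 5, 6).  With
  the index of \<open>p\<close> read modulo 3, \<open>v\<^sub>j\<^sub>s\<close> maps \<open>p\<^sub>j\<close> to \<open>q\<^sub>s\<close> and \<open>p\<^sub>j\<^sub>+\<^sub>1\<close> to \<open>q'\<^sub>s\<close>, and kills the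
  rest of the basis.  Since basis vectors go to basis vectors or to 0, the action is a partial
  function on indices; \<open>a + 2\<close> stands for \<open>a - 1\<close> modulo 3.
\<close>

definition module_act :: "nat \<Rightarrow> nat \<Rightarrow> nat option" where
  "module_act a x =
    (if 7 \<le> a \<or> 7 \<le> x then None
     else if a = 0 then Some x
     else if x = (a + 2) mod 3 then Some (3 + (a - 1) div 3)
     else if x = a mod 3 then Some (5 + (a - 1) div 3)
     else None)"

definition module_tensor :: tensor where
  "module_tensor = (\<lambda>(a, x, y). of_bool (module_act a x = Some y))"

definition algebra_mult :: "nat \<Rightarrow> nat \<Rightarrow> nat option" where
  "algebra_mult a b = (if a = 0 then Some b else if b = 0 then Some a else None)"

lemma module_act_less: "module_act a x = Some y \<Longrightarrow> a < 7 \<and> x < 7 \<and> y < 7"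
  by (auto simp: module_act_def split: if_splits)

lemma module_tensor_in_tensors: "module_tensor \<in> tensors 7"
  using module_act_less by (fastforce simp: module_tensor_def tensors_def)

lemma module_act_commute:
  assumes "a < 7" "b < 7" "x < 7"
  shows "Option.bind (algebra_mult a b) (\<lambda>c. module_act c x)
      = Option.bind (module_act b x) (module_act a)"
    and "Option.bind (module_act b x) (module_act a) = Option.bind (module_act a x) (module_act b)"
proof -
  have "\<forall>a\<in>set [0..<7]. \<forall>b\<in>set [0..<7]. \<forall>x\<in>set [0..<7].
      Option.bind (algebra_mult a b) (\<lambda>c. module_act c x)
        = Option.bind (module_act b x) (module_act a) \<and>
      Option.bind (module_act b x) (module_act a) = Option.bind (module_act a x) (module_act b)"
    by code_simp
  then show "Option.bind (algebra_mult a b) (\<lambda>c. module_act c x)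
      = Option.bind (module_act b x) (module_act a)"
    and "Option.bind (module_act b x) (module_act a) = Option.bind (module_act a x) (module_act b)"
    using assms by auto
qed

lemma sum_of_bool_Some:
  fixes f :: "nat \<Rightarrow> nat option"
  assumes "\<And>s. u = Some s \<Longrightarrow> s < m"
  shows "(\<Sum>s<m. of_bool (u = Some s) * of_bool (f s = Some k))
    = (of_bool (Option.bind u f = Some k) :: complex)"
proof (cases u)
  case (Some t)
  have "(\<Sum>s<m. of_bool (u = Some s) * of_bool (f s = Some k))
      = (\<Sum>s<m. if s = t then of_bool (f t = Some k) else (0 :: complex))"
    using Some by (intro sum.cong) auto
  then show ?thesis using assms Some by simp
qed simp

text \<open>
  Every element \<open>b\<close> of the algebra gives an element of the 111-algebra: multiplying the algebra
  argument by \<open>b\<close>, applying \<open>b\<close> to the module argument and applying \<open>b\<close> to the result all turn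
  \<open>a \<otimes> x \<mapsto> ax\<close> into \<open>a \<otimes> x \<mapsto> abx\<close>.  The algebra has dimension \<open>m\<close>, and its elements are told
  apart by their products with the identity, row 0 of the matrices \<open>X\<close>.
\<close>

lemma satisfies_111_module_tensor: "satisfies_111 7 module_tensor"
proof (rule satisfies_111I[where piv = "\<lambda>r. (0, r)"])
  let ?X = "\<lambda>b (i, s). of_bool (algebra_mult i b = Some s) :: complex"
  let ?Y = "\<lambda>b (j, s). of_bool (module_act b j = Some s) :: complex"
  let ?Z = "\<lambda>b (k, s). of_bool (module_act b s = Some k) :: complex"
  have X: "act_A 7 (?X b) module_tensor (i, j, k)
      = of_bool (i < 7 \<and> Option.bind (algebra_mult i b) (\<lambda>c. module_act c j) = Some k)"
    if "b < 7" for b i j k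
    using sum_of_bool_Some[of "algebra_mult i b" 7 "\<lambda>c. module_act c j" k] that
    by (auto simp: act_A_def module_tensor_def algebra_mult_def split: if_splits)
  have Y: "act_B 7 (?Y b) module_tensor (i, j, k)
      = of_bool (Option.bind (module_act b j) (module_act i) = Some k)" for b i j k
    using sum_of_bool_Some[of "module_act b j" 7 "module_act i" k] module_act_less[of b j]
    by (auto simp: act_B_def module_tensor_def bind_eq_Some_conv)
  have Z: "act_C 7 (?Z b) module_tensor (i, j, k)
      = of_bool (Option.bind (module_act i j) (module_act b) = Some k)" for b i j k
    using sum_of_bool_Some[of "module_act i j" 7 "module_act b" k] module_act_less[of i j]
      module_act_less[of b _ k]
    by (auto simp: act_C_def module_tensor_def bind_eq_Some_conv mult.commute)
  have outside: "Option.bind (module_act b j) (module_act i) \<noteq> Some k"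
    "Option.bind (module_act i j) (module_act b) \<noteq> Some k"
    "i < 7 \<Longrightarrow> Option.bind (algebra_mult i b) (\<lambda>c. module_act c j) \<noteq> Some k"
    if "\<not> (i < 7 \<and> j < 7)" for b i j k
    using that module_act_less by (auto simp: bind_eq_Some_conv)
  show "act_A 7 (?X b) module_tensor = act_B 7 (?Y b) module_tensor" if "b < 7" for b
  proof (rule ext, clarify)
    fix i j k
    show "act_A 7 (?X b) module_tensor (i, j, k) = act_B 7 (?Y b) module_tensor (i, j, k)"
    proof (cases "i < 7 \<and> j < 7")
      case True
      then show ?thesis unfolding X[OF that] Y using module_act_commute(1)[of i b j] that by simp
    qed (use X[OF that] Y outside[of i j] in auto)
  qed
  show "act_B 7 (?Y b) module_tensor = act_C 7 (?Z b) module_tensor" if "b < 7" for b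
  proof (rule ext, clarify)
    fix i j k
    show "act_B 7 (?Y b) module_tensor (i, j, k) = act_C 7 (?Z b) module_tensor (i, j, k)"
    proof (cases "i < 7 \<and> j < 7")
      case True
      then show ?thesis unfolding Y Z using module_act_commute(2)[of i b j] that by simp
    qed (use Y Z outside[of i j] in auto)
  qed
qed (auto simp: algebra_mult_def)

lemma concise_module_tensor: "concise 7 module_tensor"
proof (rule conciseI)
  have unit: "module_act 0 x = Some y \<longleftrightarrow> x < 7 \<and> x = y" for x y
    by (auto simp: module_act_def)
  show "\<exists>i k. module_tensor (i, x, k) \<noteq> 0 \<and> (\<forall>s<7. s \<noteq> x \<longrightarrow> module_tensor (i, s, k) = 0)"
    "\<exists>i j. module_tensor (i, j, x) \<noteq> 0 \<and> (\<forall>s<7. s \<noteq> x \<longrightarrow> module_tensor (i, j, s) = 0)"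
    if "x < 7" for x
    by (rule exI[of _ 0], rule exI[of _ x], use that unit in \<open>simp add: module_tensor_def\<close>)+
  fix a :: nat assume a: "a < 7"
  have "\<forall>a\<in>set [0..<7]. \<exists>x\<in>set [0..<7]. \<exists>y\<in>set [0..<7].
      module_act a x = Some y \<and> (\<forall>s\<in>set [0..<7]. s \<noteq> a \<longrightarrow> module_act s x \<noteq> Some y)"
    by code_simp
  then obtain x y where "module_act a x = Some y"
    "\<And>s. s < 7 \<Longrightarrow> s \<noteq> a \<Longrightarrow> module_act s x \<noteq> Some y"
    using a by (metis atLeast0LessThan lessThan_iff set_upt)
  then show "\<exists>x y. module_tensor (a, x, y) \<noteq> 0 \<and> (\<forall>s<7. s \<noteq> a \<longrightarrow> module_tensor (s, x, y) = 0)"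
    by (intro exI[of _ x] exI[of _ y]) (simp add: module_tensor_def)
qed

text \<open>
  With the module argument as the distinguished factor, the kernel of the Koszul flattening
  consists of the linear maps \<open>\<psi>\<close> from the module to the algebra with \<open>\<psi>(x)y = \<psi>(y)x\<close>.  The column
  \<open>(x, a)\<close> belongs to the coefficient of \<open>a\<close> in \<open>\<psi>(x)\<close>, and the row of \<open>{x, t}\<close> and \<open>l\<close> to the
  coefficient of \<open>l\<close> in \<open>\<psi>(x)t - \<psi>(t)x\<close>.  The six columns \<open>(p\<^sub>j\<^sub>+\<^sub>2, v\<^sub>j\<^sub>s)\<close>, left out of the minor, are
  those that determine \<open>\<psi>\<close>.
\<close>

definition dropped :: "nat \<times> nat \<Rightarrow> bool" where
  "dropped = (\<lambda>(x, a). 0 < a \<and> x = (a + 1) mod 3)"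

text \<open>
  The pivot row of the column \<open>(x, a)\<close> is that of \<open>{x, t}\<close> and \<open>l\<close> for \<open>(t, l) = partner x a\<close>.
  Here \<open>t\<close> is a basis vector of the module other than \<open>x\<close> that \<open>a\<close> maps to \<open>l\<close>.  For \<open>a = v\<^sub>j\<^sub>s\<close>
  there are two pairs \<open>(t, l)\<close> with \<open>at = l\<close>, namely \<open>(p\<^sub>j, q\<^sub>s)\<close> and \<open>(p\<^sub>j\<^sub>+\<^sub>1, q'\<^sub>s)\<close>; the second is taken
  if the first has \<open>t = x\<close>, or has \<open>l = x\<close>, when the coefficient of \<open>1\<close> in \<open>\<psi>(t)\<close> would interfere.
\<close>

definition partner :: "nat \<Rightarrow> nat \<Rightarrow> nat \<times> nat" where
  "partner x a =
    (if a = 0 then let t = if x < 3 then (x + 1) mod 3 else 0 in (t, t)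
     else if x = (a + 2) mod 3 \<or> x = 3 + (a - 1) div 3 then (a mod 3, 5 + (a - 1) div 3)
     else ((a + 2) mod 3, 3 + (a - 1) div 3))"

text \<open>
  In the pivot row of the column \<open>(x, a)\<close> the term \<open>\<psi>(x)t\<close> contributes only that column, since no
  other basis element of the algebra maps \<open>t\<close> to \<open>l\<close>, and the term \<open>\<psi>(t)x\<close> contributes at most
  columns that were left out.
\<close>

lemma partner_isolates_column:
  assumes "x < 7" "a < 7" "\<not> dropped (x, a)" "partner x a = (t, l)"
  shows "t < 7" "l < 7" "t \<noteq> x"
    and "a' < 7 \<Longrightarrow> module_act a' t = Some l \<longleftrightarrow> a' = a"
    and "a' < 7 \<Longrightarrow> module_act a' x = Some l \<Longrightarrow> dropped (t, a')"
proof -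
  have "\<forall>x\<in>set [0..<7]. \<forall>a\<in>set [0..<7]. \<not> dropped (x, a) \<longrightarrow>
     (case partner x a of (t, l) \<Rightarrow> t < 7 \<and> l < 7 \<and> t \<noteq> x \<and>
       (\<forall>a'\<in>set [0..<7]. (module_act a' t = Some l \<longleftrightarrow> a' = a) \<and>
          (module_act a' x = Some l \<longrightarrow> dropped (t, a'))))"
    by code_simp
  note bspec[OF bspec[OF this, of x], of a]
  then have "t < 7 \<and> l < 7 \<and> t \<noteq> x \<and>
      (\<forall>a'\<in>set [0..<7]. (module_act a' t = Some l \<longleftrightarrow> a' = a) \<and>
        (module_act a' x = Some l \<longrightarrow> dropped (t, a')))"
    using assms by simp
  then have "t < 7 \<and> l < 7 \<and> t \<noteq> x \<and>
      (\<forall>a'<7. (module_act a' t = Some l \<longleftrightarrow> a' = a) \<and> (module_act a' x = Some l \<longrightarrow> dropped (t, a')))"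
    by (metis atLeast0LessThan lessThan_iff set_upt)
  then show "t < 7" "l < 7" "t \<noteq> x"
    and "a' < 7 \<Longrightarrow> module_act a' t = Some l \<longleftrightarrow> a' = a"
    and "a' < 7 \<Longrightarrow> module_act a' x = Some l \<Longrightarrow> dropped (t, a')"
    by blast+
qed

text \<open>
  The \<open>49 - 6 = 43 = 7 \<cdot> 6 + 1\<close> remaining columns and their pivot rows form a diagonal matrix.
\<close>

lemma not_koszul_210_module_tensor: "\<not> koszul_210 7 (\<lambda>(x, a, y). module_tensor (a, x, y))"
  (is "\<not> koszul_210 7 ?T")
  unfolding koszul_210_def
proof (rule not_minors_vanish_if_diagonal)
  let ?cols = "set (filter (\<lambda>\<sigma>. \<not> dropped \<sigma>) (List.product [0..<7] [0..<7]))"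
  let ?row = "\<lambda>(x, a). case partner x a of (t, l) \<Rightarrow> ((min x t, max x t), l)"
  show "finite ?cols" "?cols \<subseteq> koszul_cols 7"
    by (auto simp: koszul_cols_def)
  have "card ?cols = length (filter (\<lambda>\<sigma>. \<not> dropped \<sigma>) (List.product [0..<7] [0..<7]))"
    by (intro distinct_card distinct_filter distinct_product) simp_all
  also have "\<dots> = 43" by code_simp
  finally show "card ?cols = 7 * (7 - 1) + 1" by simp
  show "?row \<sigma> \<in> koszul_rows 7" if "\<sigma> \<in> ?cols" for \<sigma>
  proof -
    obtain x a t l where \<sigma>: "\<sigma> = (x, a)" "partner x a = (t, l)" by (metis surj_pair)
    then show ?thesis
      using partner_isolates_column[of x a t l] that
      by (auto simp: koszul_rows_def min_def max_def)
  qed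
  show "koszul_entry 7 ?T (?row \<sigma>) \<tau> \<noteq> 0 \<longleftrightarrow> \<sigma> = \<tau>" if "\<sigma> \<in> ?cols" "\<tau> \<in> ?cols" for \<sigma> \<tau>
  proof -
    obtain x a t l where \<sigma>: "\<sigma> = (x, a)" "partner x a = (t, l)" by (metis surj_pair)
    obtain x' a' where \<tau>: "\<tau> = (x', a')" by (metis surj_pair)
    have x: "x < 7" "a < 7" "\<not> dropped (x, a)" and a': "a' < 7" "\<not> dropped (x', a')"
      using that \<sigma> \<tau> by auto
    note p = partner_isolates_column[OF x \<sigma>(2)]
    have "koszul_entry 7 ?T (?row \<sigma>) \<tau> \<noteq> 0 \<longleftrightarrow>
        x' = x \<and> module_act a' t = Some l \<or> x' = t \<and> module_act a' x = Some l"
      using p(1-3) x a' by (auto simp: \<sigma> \<tau> koszul_entry_eq module_tensor_def min_def max_def)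
    then show ?thesis using p(4,5)[OF a'(1)] a'(2) \<sigma> \<tau> by auto
  qed
qed

theorem proposition1p3:
  "(\<exists>(m::nat) T. T \<in> tensors m \<and> concise m T \<and> satisfies_koszul m T \<and> \<not> satisfies_111 m T) \<and>
   (\<exists>(m::nat) T. T \<in> tensors m \<and> concise m T \<and> satisfies_111 m T \<and> \<not> satisfies_koszul m T)"
proof
  have "cyclic_tensor 2 3 \<in> tensors 4"
    by (auto simp: tensors_def cyclic_tensor_def)
  then show "\<exists>m T. T \<in> tensors m \<and> concise m T \<and> satisfies_koszul m T \<and> \<not> satisfies_111 m T"
    using concise_cyclic_tensor satisfies_koszul_cyclic_tensor not_satisfies_111_cyclic_tensor
    by blast
  have "\<not> satisfies_koszul 7 module_tensor"
    using not_koszul_210_module_tensor by (simp add: satisfies_koszul_def)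
  then show "\<exists>m T. T \<in> tensors m \<and> concise m T \<and> satisfies_111 m T \<and> \<not> satisfies_koszul m T"
    using module_tensor_in_tensors concise_module_tensor satisfies_111_module_tensor by blast
qed

end
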